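(* Let $(x_k)$, $(g_k)$, $(d_k)$, $(w_k)$, $(\Delta_k)$, $(B_k)$, $(s_k)$ be generated by the ADAGB2 algorithm (defined in the context, with constants $\varsigma,\tau\in(0,1]$ and $\kappa_s\ge 1$) applied to the problem $\min_{x\in\mathcal F} f(x)$, $\mathcal F=\{x\in\mathbb R^n\mid l_i\le x_i\le u_i,\ i=1,\dots,n\}$. Write $G_k=\nabla f(x_k)$. Suppose that: (1) $f$ is twice continuously differentiable and $\mathcal F\neq\emptyset$; (2) there is $L\ge 0$ such that $\|\nabla f(x)-\nabla f(y)\|\le L\|x-y\|$ for all $x,y\in\mathbb R^n$; (3) there is $\kappa_B\ge 1$ such that $\|B_k\|\le\kappa_B$ for all $k\ge 0$; (4) there is a constant $f_{\rm low}<f(x_0)$ such that $f(x)\ge f_{\rm low}$ for all $x\in\mathcal F$; (5) there is $\kappa_{Gg}>0$ such that $\mathbb E_k\big[|(G_k-g_k)^Ts_k|\big]\le \kappa_{Gg}^2\,\mathbb E_k\big[\|s_k\|^2\big]$ for all $k\ge 0$. Then, for all $k\ge 0$, $$\mathbb E\left[\frac1{k+1}\sum_{j=0}^k\|d_j\|\right]\le\frac{\kappa_{\rm conv}}{\sqrt{k+1}},$$ where, with $\Gamma_0=f(x_0)-f_{\rm low}$, $$\kappa_{\rm conv}=\frac{4\kappa_B}{\tau\varsigma^2}\left\{1+\Gamma_0+2n\kappa_*\left[\log\left(\frac{8n\kappa_*\kappa_B}{\tau\varsigma^{5/2}}\right)-1\right]\right\},\qquad \kappa_*=\kappa_s^2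\left(\kappa_{Gg}^2+\tfrac12(\kappa_B+L)\right).$$
   Context: Problem and notation. $\|\cdot\|$ is the Euclidean norm (and the induced matrix norm). $l,u$ are vectors of bounds, with infinite entries allowed ($l_i=-\infty$, $u_i=+\infty$); $f$ is a real-valued function defined on an open set containing $\mathcal F$ (the Lipschitz hypothesis being stated on all of $\mathbb R^n$ presumes $\nabla f$ is defined there). For a nonempty closed box $S$, $P_S$ is the Euclidean projection onto $S$ (computed componentwise). $v_i$ or $v_{k,i}$ is the $i$-th component of $v$ or $v_k$. ADAGB2 algorithm. Inputs: deterministic $x_{\rm ini}\in\mathbb R^n$, $l$, $u$. Constants $\varsigma,\tau\in(0,1]$, $\kappa_s\ge1$. Set $x_0=P_{\mathcal F}(x_{\rm ini})$ and $w_{-1,i}=\sqrt{\varsigma}$ for all $i$. For $k=0,1,2,\dots$: Step 1. Obtain $g_k=g(x_k,\xi)$, a random approximation of $G_k=\nabla f(x_k)$ (no unbiasedness is assumed). Set $d_k=P_{\mathcal F}(x_k-g_k)-x_k$ and, for each $i$, $w_{k,i}=\sqrt{w_{k-1,i}^2+d_{k,i}^2}$, $\Delta_{k,i}=|d_{k,i}|/w_{k,i}$. Let $\mathcal B_k=\{x\in\mathbb R^n\mid |x_i-x_{k,i}|\le\Delta_{k,i},\ i=1,\dots,n\}$ and $s_k^L=P_{\mathcal F\cap\mathcal B_k}(x_k-g_k)-x_k$. Step 2. Choose a symmetric matrix $B_k\in\mathbb R^{n\times n}$ (an approximation of $\nabla^2 f(x_k)$; any symmetric matrix, including $0$, is allowed).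 Set $s_k^Q=\gamma_k s_k^L$, where $\gamma_k=\min\left[1,\frac{-g_k^Ts_k^L}{(s_k^L)^TB_ks_k^L}\right]$ if $(s_k^L)^TB_ks_k^L>0$ and $\gamma_k=1$ otherwise. Select any $s_k$ such that $x_k+s_k\in\mathcal F$, $|s_{k,i}|\le\kappa_s\Delta_{k,i}$ for all $i$, and $g_k^Ts_k+\frac12 s_k^TB_ks_k\le\tau\left(g_k^Ts_k^Q+\frac12(s_k^Q)^TB_ks_k^Q\right)$. Step 3. Set $x_{k+1}=x_k+s_k$. The algorithm generates a random process on a probability space. $\mathbb E_k[\cdot]$ denotes expectation conditioned on knowing $g_0,\dots,g_{k-1}$ (the past up to iteration $k$, by which $x_k$ is regarded as determined) and $\mathbb E[\cdot]$ the full expectation. All random quantities are assumed measurable and the expectations well defined; relations between conditional expectations hold almost surely. *)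

theory Defs
  imports "HOL-Probability.Probability"
begin

section \<open>Smooth functions on real n-space\<close>

text \<open>Meaningful only where \<open>f\<close> is differentiable (the gradient is then unique).\<close>

definition gradient :: "(real ^ 'n \<Rightarrow> real) \<Rightarrow> real ^ 'n \<Rightarrow> real ^ 'n" where
  "gradient f x = (THE D. GDERIV f x :> D)"

text \<open>Intended for open \<open>U\<close>; \<open>H\<close> is the Hessian.\<close>

definition twice_continuously_differentiable_on ::
    "(real ^ 'n \<Rightarrow> real) \<Rightarrow> (real ^ 'n) set \<Rightarrow> bool" where
  "twice_continuously_differentiable_on f U \<longleftrightarrow>
     (\<exists>H :: real ^ 'n \<Rightarrow> real ^ 'n ^ 'n.
        (\<forall>x\<in>U. GDERIV f x :> gradient f x \<and>
               (gradient f has_derivative (\<lambda>h. H x *v h)) (at x)) \<and>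
        continuous_on U H)"


section \<open>The ADAGB2 algorithm\<close>

definition feasible_box :: "ereal ^ 'n \<Rightarrow> ereal ^ 'n \<Rightarrow> (real ^ 'n) set" where
  "feasible_box l u = {x. \<forall>i. l $ i \<le> ereal (x $ i) \<and> ereal (x $ i) \<le> u $ i}"

definition trust_box :: "real ^ 'n \<Rightarrow> real ^ 'n \<Rightarrow> (real ^ 'n) set" where
  "trust_box x \<Delta> = {y. \<forall>i. \<bar>y $ i - x $ i\<bar> \<le> \<Delta> $ i}"

definition quad_model :: "real ^ 'n \<Rightarrow> real ^ 'n ^ 'n \<Rightarrow> real ^ 'n \<Rightarrow> real" where
  "quad_model g B s = g \<bullet> s + (1/2) * (s \<bullet> (B *v s))"

definition linear_step ::
    "(real ^ 'n) set \<Rightarrow> real ^ 'n \<Rightarrow> real ^ 'n \<Rightarrow> real ^ 'n \<Rightarrow> real ^ 'n" where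
  "linear_step F x g \<Delta> = closest_point (F \<inter> trust_box x \<Delta>) (x - g) - x"

definition step_scaling :: "real ^ 'n \<Rightarrow> real ^ 'n ^ 'n \<Rightarrow> real ^ 'n \<Rightarrow> real" where
  "step_scaling g B sL =
     (if sL \<bullet> (B *v sL) > 0 then min 1 (- (g \<bullet> sL) / (sL \<bullet> (B *v sL))) else 1)"

definition quadratic_step ::
    "(real ^ 'n) set \<Rightarrow> real ^ 'n \<Rightarrow> real ^ 'n \<Rightarrow> real ^ 'n \<Rightarrow> real ^ 'n ^ 'n \<Rightarrow> real ^ 'n" where
  "quadratic_step F x g \<Delta> B =
     (let sL = linear_step F x g \<Delta> in step_scaling g B sL *\<^sub>R sL)"

text \<open>
  One realization of the algorithm. The approximate gradients \<open>g k\<close>, the symmetric matrices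
  \<open>B k\<close> and the steps \<open>s k\<close> are arbitrary choices subject to the listed requirements. The
  initial weights, of index -1 in the usual numbering, are the \<open>0\<close> branch of the case
  distinction.
\<close>

definition adagb2_run ::
    "real \<Rightarrow> real \<Rightarrow> real \<Rightarrow> ereal ^ 'n \<Rightarrow> ereal ^ 'n \<Rightarrow> real ^ 'n \<Rightarrow>
     (nat \<Rightarrow> real ^ 'n) \<Rightarrow> (nat \<Rightarrow> real ^ 'n) \<Rightarrow> (nat \<Rightarrow> real ^ 'n) \<Rightarrow> (nat \<Rightarrow> real ^ 'n) \<Rightarrow>
     (nat \<Rightarrow> real ^ 'n) \<Rightarrow> (nat \<Rightarrow> real ^ 'n ^ 'n) \<Rightarrow> (nat \<Rightarrow> real ^ 'n) \<Rightarrow> bool" where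
  "adagb2_run varsigma \<tau> \<kappa>s l u xini x g d w \<Delta> B s \<longleftrightarrow>
     x 0 = closest_point (feasible_box l u) xini \<and>
     (\<forall>k.
        d k = closest_point (feasible_box l u) (x k - g k) - x k \<and>
        (\<forall>i. w k $ i =
               sqrt ((case k of 0 \<Rightarrow> sqrt varsigma | Suc j \<Rightarrow> w j $ i)\<^sup>2 + (d k $ i)\<^sup>2)) \<and>
        (\<forall>i. \<Delta> k $ i = \<bar>d k $ i\<bar> / w k $ i) \<and>
        transpose (B k) = B k \<and>
        x k + s k \<in> feasible_box l u \<and>
        (\<forall>i. \<bar>s k $ i\<bar> \<le> \<kappa>s * \<Delta> k $ i) \<and>
        quad_model (g k) (B k) (s k)
          \<le> \<tau> * quad_model (g k) (B k)
                   (quadratic_step (feasible_box l u) (x k) (g k) (\<Delta> k) (B k)) \<and>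
        x (Suc k) = x k + s k)"


section \<open>Conditioning on the past\<close>

text \<open>
  The sigma-algebra generated by \<open>g 0, \<dots>, g (k - 1)\<close>; for \<open>k = 0\<close> it is the trivial one on
  \<open>space M\<close>.
\<close>

definition past_algebra :: "'a measure \<Rightarrow> (nat \<Rightarrow> 'a \<Rightarrow> real ^ 'n) \<Rightarrow> nat \<Rightarrow> 'a measure" where
  "past_algebra M g k =
     sigma (space M) {g j -` A \<inter> space M | j A. j < k \<and> A \<in> sets borel}"


section \<open>Constants\<close>

definition kappa_star :: "real \<Rightarrow> real \<Rightarrow> real \<Rightarrow> real \<Rightarrow> real" where
  "kappa_star \<kappa>s \<kappa>Gg \<kappa>B L = \<kappa>s\<^sup>2 * (\<kappa>Gg\<^sup>2 + (1/2) * (\<kappa>B + L))"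

definition kappa_conv :: "nat \<Rightarrow> real \<Rightarrow> real \<Rightarrow> real \<Rightarrow> real \<Rightarrow> real \<Rightarrow> real" where
  "kappa_conv n varsigma \<tau> \<kappa>B \<kappa>star \<Gamma>0 =
     4 * \<kappa>B / (\<tau> * varsigma\<^sup>2) *
       (1 + \<Gamma>0 + 2 * real n * \<kappa>star *
          (ln (8 * real n * \<kappa>star * \<kappa>B / (\<tau> * varsigma powr (5/2))) - 1))"

end

theory Submission
  imports Defs
begin

text \<open>
  Everything rests on a bound, independent of \<open>k\<close>, for the expectation of the sum \<open>W\<close> of the
  weights \<open>w\<^sub>k\<^sub>,\<^sub>i\<close> over all coordinates. It results from two opposite
  estimates, one linear and one logarithmic in the weights.

  Along every realization, the quadratic model decreases in step \<open>j\<close> by at least a constant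
  times \<open>\<Sum>i. d\<^sub>j\<^sub>,\<^sub>i\<^sup>2 / w\<^sub>j\<^sub>,\<^sub>i\<close>
  (\<open>model_decrease\<close>). The objective follows the model up to the gradient error
  \<open>\<bar>(G\<^sub>j - g\<^sub>j) \<bullet> s\<^sub>j\<bar>\<close> and a multiple of
  \<open>\<parallel>s\<^sub>j\<parallel>\<^sup>2\<close> (\<open>objective_decrease\<close>). Since the objective is bounded
  below, summation bounds the accumulated model decrease, which is itself at least linear in
  \<open>W\<close>, because the square of each weight is the accumulated sum of the squares
  \<open>d\<^sub>j\<^sub>,\<^sub>i\<^sup>2\<close>, up to the initial value
  (\<open>sum_weights_le\<close>).

  In the other direction, the steps are confined to boxes of half-width proportional to
  \<open>\<bar>d\<^sub>j\<^sub>,\<^sub>i\<bar> / w\<^sub>j\<^sub>,\<^sub>i\<close>, so that the sum of the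
  \<open>\<parallel>s\<^sub>j\<parallel>\<^sup>2\<close> grows only logarithmically with the weights
  (\<open>sum_step_norm_sq\<close>). By hypothesis the expected gradient error is at most a multiple of the
  expected \<open>\<parallel>s\<^sub>j\<parallel>\<^sup>2\<close>, so the expectation of all error terms is logarithmic
  in the weights as well.

  A quantity bounded by its own logarithm is bounded: a suitable tangent line to the logarithm
  (\<open>ln_ratio_tangent\<close>) absorbs half of the linear term, and the expectation of \<open>W\<close> is at
  most the stated constant (\<open>le_kappa_conv\<close>), independently of \<open>k\<close>. Finally the
  Cauchy-Schwarz inequality bounds the sum of the \<open>\<parallel>d\<^sub>j\<parallel>\<close> by
  \<open>sqrt (k + 1) * W\<close> (\<open>sum_norm_le_weights\<close>).
\<close>


section \<open>Projections onto boxes\<close>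

lemma box_convex:
  fixes I :: "'n::finite \<Rightarrow> real set"
  assumes "\<And>i. convex (I i)"
  shows "convex {y :: real ^ 'n. \<forall>i. y $ i \<in> I i}"
  using assms by (auto simp: convex_def)

lemma box_closed:
  fixes I :: "'n::finite \<Rightarrow> real set"
  assumes "\<And>i. closed (I i)"
  shows "closed {y :: real ^ 'n. \<forall>i. y $ i \<in> I i}"
proof -
  have "{y :: real ^ 'n. \<forall>i. y $ i \<in> I i} = (\<Inter>i. (\<lambda>y. y $ i) -` I i)"
    by auto
  then show ?thesis
    using assms by (auto intro!: closed_INT closed_vimage continuous_intros)
qed

text \<open>
  The variational inequality of a projection splits into one inequality per coordinate for a
  box, because a single coordinate of the projected point may be moved within its interval
  without leaving the box. Comparing with well-chosen values \<open>t\<close> of that coordinate then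
  does the work of an explicit clipping formula.
\<close>

lemma closest_point_box_coordinate:
  fixes I :: "'n::finite \<Rightarrow> real set"
  assumes conv: "\<And>i. convex (I i)" and clos: "\<And>i. closed (I i)"
    and S: "S = {y :: real ^ 'n. \<forall>i. y $ i \<in> I i}" and ne: "S \<noteq> {}" and t: "t \<in> I i"
  shows "(a $ i - closest_point S a $ i) * (t - closest_point S a $ i) \<le> 0"
proof -
  define p where "p = closest_point S a"
  have S': "convex S" "closed S"
    unfolding S by (rule box_convex[OF conv], rule box_closed[OF clos])
  have "p \<in> S"
    unfolding p_def using S' ne by (simp add: closest_point_in_set)
  define q where "q = (\<chi> m. if m = i then t else p $ m)"
  have "q \<in> S"
    using \<open>p \<in> S\<close> t unfolding S q_def by auto
  then have "(a - p) \<bullet> (q - p) \<le> 0"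
    unfolding p_def using S' by (intro closest_point_dot) auto
  also have "(a - p) \<bullet> (q - p) = (\<Sum>m\<in>UNIV. if m = i then (a $ i - p $ i) * (t - p $ i) else 0)"
    unfolding inner_vec_def by (rule sum.cong) (auto simp: q_def)
  finally show ?thesis
    by (simp add: p_def)
qed

lemma ereal_interval_convex: "convex {t. a \<le> ereal t \<and> ereal t \<le> b}"
proof -
  have "is_interval {t. a \<le> ereal t \<and> ereal t \<le> b}"
    unfolding is_interval_1 by (auto intro: order_trans[where y = "ereal _"])
  then show ?thesis
    by (rule is_interval_convex)
qed

lemma ereal_interval_closed: "closed {t. a \<le> ereal t \<and> ereal t \<le> b}"
  by (intro closed_Collect_conj closed_Collect_le continuous_intros)

lemma feasible_box_as_box:
  "feasible_box l u = {y. \<forall>i. y $ i \<in> {t. l $ i \<le> ereal t \<and> ereal t \<le> u $ i}}"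
  by (simp add: feasible_box_def)

lemma feasible_box_convex: "convex (feasible_box l u)"
  unfolding feasible_box_as_box by (rule box_convex) (rule ereal_interval_convex)

lemma feasible_box_closed: "closed (feasible_box l u)"
  unfolding feasible_box_as_box by (rule box_closed) (rule ereal_interval_closed)


section \<open>Decrease of the quadratic model\<close>

text \<open>
  Here \<open>d\<close> and \<open>\<sigma>\<close> are one coordinate of the projected gradient step and of the
  trust-region step. The first inequality between \<open>g\<close> and \<open>d\<close> puts them in opposite
  directions with \<open>\<bar>g\<bar> \<ge> \<bar>d\<bar>\<close>, unless \<open>d = 0\<close>; the variational inequality then forces
  \<open>\<sigma>\<close> to reach at least as far as \<open>\<theta> * d\<close>, since otherwise both of its factors would have the sign of \<open>d\<close>.
\<close>

lemma projected_component_decrease: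
  fixes g d \<sigma> \<theta> :: real
  assumes \<theta>: "0 \<le> \<theta>" "\<theta> \<le> 1" and gd: "g * d + d\<^sup>2 \<le> 0"
    and vi: "(- g - \<sigma>) * (\<theta> * d - \<sigma>) \<le> 0"
  shows "g * \<sigma> \<le> - (\<theta> * d\<^sup>2)"
proof -
  have gd': "d * (g + d) \<le> 0"
    using gd by (simp add: algebra_simps power2_eq_square)
  consider "d = 0" | "d > 0" | "d < 0" by linarith
  then show ?thesis
  proof cases
    case 1
    have "0 \<le> \<sigma> * \<sigma>" by simp
    moreover have "\<sigma> * \<sigma> + g * \<sigma> \<le> 0"
      using vi 1 by (simp add: algebra_simps)
    ultimately have "g * \<sigma> \<le> 0" by linarith
    then show ?thesis
      using 1 by simp
  next
    case 2
    then have g: "g \<le> - d"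
      using gd' by (simp add: mult_le_0_iff)
    have "\<theta> * d \<le> d"
      using 2 \<theta> by (simp add: mult_left_le_one_le)
    have "\<theta> * d \<le> \<sigma>"
    proof (rule ccontr)
      assume "\<not> \<theta> * d \<le> \<sigma>"
      then have "0 < (- g - \<sigma>) * (\<theta> * d - \<sigma>)"
        using g \<open>\<theta> * d \<le> d\<close> by (intro mult_pos_pos) auto
      then show False using vi by simp
    qed
    then have "d * (\<theta> * d) \<le> (- g) * \<sigma>"
      using g 2 \<theta> by (intro mult_mono) auto
    then show ?thesis
      by (simp add: algebra_simps power2_eq_square)
  next
    case 3
    then have g: "- d \<le> g"
      using gd' by (simp add: mult_le_0_iff)
    have "d \<le> \<theta> * d"
      using 3 \<theta> by (simp add: mult_le_cancel_right1)
    have "\<sigma> \<le> \<theta> * d"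
    proof (rule ccontr)
      assume "\<not> \<sigma> \<le> \<theta> * d"
      then have "0 < (- g - \<sigma>) * (\<theta> * d - \<sigma>)"
        using g \<open>d \<le> \<theta> * d\<close> by (intro mult_neg_neg) auto
      then show False using vi by simp
    qed
    moreover have "\<theta> * d \<le> 0"
      using 3 \<theta> by (simp add: mult_nonneg_nonpos)
    ultimately have "(- d) * (- (\<theta> * d)) \<le> g * (- \<sigma>)"
      using g 3 by (intro mult_mono) auto
    then show ?thesis
      by (simp add: algebra_simps power2_eq_square)
  qed
qed

text \<open>
  The scaling is the minimizer of the model along the linear step, cut off at 1. If the cut-off
  is active, at least half of the linear decrease survives; otherwise the minimal value is
  \<open>- (g \<bullet> sL)\<^sup>2 / (2 * (sL \<bullet> B sL))\<close>, in which the two hypotheses on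
  \<open>sL\<close> together bound the curvature by \<open>\<kappa>B\<close> times the linear decrease.
\<close>

lemma quad_model_scaled_step:
  fixes sL :: "real ^ 'n"
  assumes dec: "(norm sL)\<^sup>2 \<le> - (g \<bullet> sL)"
    and curv: "sL \<bullet> (B *v sL) \<le> \<kappa>B * (norm sL)\<^sup>2" and \<kappa>B: "1 \<le> \<kappa>B"
  shows "quad_model g B (step_scaling g B sL *\<^sub>R sL) \<le> (g \<bullet> sL) / (2 * \<kappa>B)"
proof -
  define a where "a = - (g \<bullet> sL)"
  define b where "b = sL \<bullet> (B *v sL)"
  define \<gamma> where "\<gamma> = step_scaling g B sL"
  have \<gamma>: "\<gamma> = (if b > 0 then min 1 (a / b) else 1)"
    by (simp add: \<gamma>_def step_scaling_def a_def b_def)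
  have m: "quad_model g B (\<gamma> *\<^sub>R sL) = - (\<gamma> * a) + \<gamma>\<^sup>2 * b / 2"
    by (simp add: quad_model_def a_def b_def matrix_vector_mult_scaleR power2_eq_square)
  have a0: "0 \<le> a"
    using dec zero_le_power2[of "norm sL"] unfolding a_def by linarith
  have ba: "b \<le> \<kappa>B * a"
    using curv dec \<kappa>B mult_left_mono[of "(norm sL)\<^sup>2" a \<kappa>B] unfolding a_def b_def by linarith
  have half: "a / (2 * \<kappa>B) \<le> a / 2"
    using a0 \<kappa>B by (intro divide_left_mono) auto
  have "- (\<gamma> * a) + \<gamma>\<^sup>2 * b / 2 \<le> - (a / (2 * \<kappa>B))"
  proof (cases "b > 0 \<and> a < b")
    case True
    then have "\<gamma> = a / b"
      by (simp add: \<gamma> min_def)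
    then have eq: "- (\<gamma> * a) + \<gamma>\<^sup>2 * b / 2 = - (a\<^sup>2 / (2 * b))"
      using True by (simp add: field_simps power2_eq_square)
    have "a * b \<le> a * (\<kappa>B * a)"
      using ba a0 by (rule mult_left_mono)
    then have "a / (2 * \<kappa>B) \<le> a\<^sup>2 / (2 * b)"
      using True \<kappa>B by (simp add: field_simps power2_eq_square)
    then show ?thesis
      using eq by simp
  next
    case False
    then have "\<gamma> = 1" "b \<le> a"
      using a0 by (auto simp: \<gamma> min_def field_simps)
    then show ?thesis
      using half by simp
  qed
  then show ?thesis
    unfolding m[symmetric] by (simp add: a_def \<gamma>_def)
qed


section \<open>Descent along segments\<close>

text \<open>
  A Lipschitz gradient keeps \<open>f\<close> below its tangent parabola: along the segment, the
  difference of the two has a derivative of the right sign.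
\<close>

lemma lipschitz_gradient_descent:
  fixes f :: "real ^ 'n \<Rightarrow> real"
  assumes conv: "convex S" and grad: "\<And>y. y \<in> S \<Longrightarrow> GDERIV f y :> G y"
    and lip: "\<And>y z. y \<in> S \<Longrightarrow> z \<in> S \<Longrightarrow> norm (G y - G z) \<le> L * norm (y - z)"
    and mem: "x \<in> S" "x + s \<in> S"
  shows "f (x + s) \<le> f x + G x \<bullet> s + L / 2 * (norm s)\<^sup>2"
proof -
  define \<phi> where "\<phi> t = f (x + t *\<^sub>R s) - t * (G x \<bullet> s) - L / 2 * (norm s)\<^sup>2 * t\<^sup>2" for t :: real
  have seg: "x + t *\<^sub>R s \<in> S" if "0 \<le> t" "t \<le> 1" for t
  proof -
    have "(1 - t) *\<^sub>R x + t *\<^sub>R (x + s) \<in> S"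
      using conv mem that by (intro convexD) auto
    then show ?thesis
      by (simp add: algebra_simps)
  qed
  have "\<phi> 1 \<le> \<phi> 0"
  proof (rule DERIV_nonpos_imp_nonincreasing[where f = \<phi>])
    fix t :: real
    assume t: "0 \<le> t" "t \<le> 1"
    let ?y = "x + t *\<^sub>R s"
    have "((\<lambda>t. x + t *\<^sub>R s) has_derivative (\<lambda>h. h *\<^sub>R s)) (at t)"
      by (auto intro!: derivative_eq_intros)
    moreover have "(f has_derivative (\<lambda>h. h \<bullet> G ?y)) (at ?y)"
      using grad[OF seg[OF t]] by (simp add: gderiv_def)
    ultimately have "((\<lambda>t. f (x + t *\<^sub>R s)) has_derivative (\<lambda>h. (h *\<^sub>R s) \<bullet> G ?y)) (at t)"
      by (rule has_derivative_compose)
    then have "((\<lambda>t. f (x + t *\<^sub>R s)) has_field_derivative (G ?y \<bullet> s)) (at t)"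
      by (rule has_derivative_imp_has_field_derivative) (simp add: inner_commute)
    then have "(\<phi> has_field_derivative
        (G ?y \<bullet> s - G x \<bullet> s - L / 2 * (norm s)\<^sup>2 * (2 * t))) (at t)"
      unfolding \<phi>_def by (auto intro!: derivative_eq_intros)
    moreover have "G ?y \<bullet> s - G x \<bullet> s \<le> L / 2 * (norm s)\<^sup>2 * (2 * t)"
    proof -
      have "G ?y \<bullet> s - G x \<bullet> s = (G ?y - G x) \<bullet> s"
        by (simp add: inner_diff_left)
      also have "\<dots> \<le> norm (G ?y - G x) * norm s"
        by (rule norm_cauchy_schwarz)
      also have "\<dots> \<le> L * norm (?y - x) * norm s"
        using lip[OF seg[OF t] mem(1)] by (rule mult_right_mono) simp
      also have "\<dots> = L / 2 * (norm s)\<^sup>2 * (2 * t)"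
        using t by (simp add: power2_eq_square)
      finally show ?thesis .
    qed
    ultimately show "\<exists>D. (\<phi> has_field_derivative D) (at t) \<and> D \<le> 0"
      by force
  qed simp
  then show ?thesis
    by (simp add: \<phi>_def)
qed


section \<open>Scalar estimates\<close>

text \<open>
  Each quotient is at most the increment of the logarithm of the denominators, by
  \<open>ln t \<le> t - 1\<close> applied to the ratio of two consecutive denominators.
\<close>

lemma sum_quotient_le_ln:
  fixes v :: "nat \<Rightarrow> real"
  assumes v0: "0 < v 0" and mono: "\<And>j. v j \<le> v (Suc j)"
  shows "(\<Sum>j\<le>k. (v (Suc j) - v j) / v (Suc j)) \<le> ln (v (Suc k) / v 0)"
proof -
  have pos: "0 < v j" for j
    by (induction j) (use v0 mono in \<open>auto intro: less_le_trans\<close>)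
  have step: "(v (Suc j) - v j) / v (Suc j) \<le> ln (v (Suc j)) - ln (v j)" for j
  proof -
    have "ln (v j / v (Suc j)) \<le> v j / v (Suc j) - 1"
      using pos by (intro ln_le_minus_one) simp
    then show ?thesis
      using pos[of j] pos[of "Suc j"] by (simp add: ln_div diff_divide_distrib)
  qed
  have "(\<Sum>j\<le>k. (v (Suc j) - v j) / v (Suc j)) \<le> (\<Sum>j\<le>k. ln (v (Suc j)) - ln (v j))"
    by (intro sum_mono step)
  also have "\<dots> = ln (v (Suc k)) - ln (v 0)"
    by (induction k) auto
  also have "\<dots> = ln (v (Suc k) / v 0)"
    using pos[of "Suc k"] v0 by (simp add: ln_div)
  finally show ?thesis .
qed

text \<open>
  The tangent line of the logarithm, at the point chosen such that its slope
  in \<open>w\<close> is \<open>c / 2\<close>: half of the linear term then remains after absorption.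
\<close>

lemma ln_ratio_tangent:
  fixes c K r w :: real
  assumes "0 < c" "0 < K" "0 < r" "0 < w"
  shows "K * ln (w\<^sup>2 / r\<^sup>2) \<le> c / 2 * w + 2 * K * (ln (4 * K / (c * r)) - 1)"
proof -
  have "ln (c * w / (4 * K)) \<le> c * w / (4 * K) - 1"
    using assms by (intro ln_le_minus_one) simp
  moreover have "ln (c * w / (4 * K)) = ln c + ln w - ln (4 * K)"
    using assms by (simp add: ln_div ln_mult)
  moreover have "ln (4 * K / (c * r)) = ln (4 * K) - ln c - ln r"
    using assms by (simp add: ln_div ln_mult)
  moreover have ln_sq: "ln (w\<^sup>2 / r\<^sup>2) = 2 * (ln w - ln r)"
    using assms by (simp add: ln_div ln_realpow)
  ultimately have "ln w - ln r \<le> c * w / (4 * K) - 1 + ln (4 * K / (c * r))"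
    by linarith
  then have "2 * K * (ln w - ln r) \<le> 2 * K * (c * w / (4 * K) - 1 + ln (4 * K / (c * r)))"
    using assms by (intro mult_left_mono) auto
  also have "\<dots> = c / 2 * w + 2 * K * (ln (4 * K / (c * r)) - 1)"
    using assms by (simp add: field_simps)
  finally show ?thesis
    by (simp only: ln_sq mult.left_commute mult.assoc)
qed

text \<open>
  The Cauchy-Schwarz inequality over the indices \<open>j\<close> gives the square root of a sum over
  the coordinates, which is at most the sum of the square roots.
\<close>

lemma sum_norm_le_sqrt_sum:
  fixes d :: "nat \<Rightarrow> real ^ 'n"
  shows "(\<Sum>j\<le>k. norm (d j)) \<le> sqrt (real (k + 1)) * (\<Sum>i\<in>UNIV. sqrt (\<Sum>j\<le>k. (d j $ i)\<^sup>2))"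
proof -
  have norm_sq: "(\<Sum>j\<le>k. (norm (d j))\<^sup>2) = (\<Sum>i\<in>UNIV. \<Sum>j\<le>k. (d j $ i)\<^sup>2)"
    by (subst sum.swap) (simp add: norm_vec_def L2_set_def sum_nonneg)
  have "(\<Sum>j\<le>k. norm (d j))\<^sup>2 \<le> (\<Sum>j\<le>k. (norm (d j))\<^sup>2) * real (k + 1)"
    using sum_squared_le_sum_of_squares[of "\<lambda>j. norm (d j)" "{..k}"] by simp
  then have "(\<Sum>j\<le>k. norm (d j)) \<le> sqrt ((\<Sum>j\<le>k. (norm (d j))\<^sup>2) * real (k + 1))"
    by (rule real_le_rsqrt)
  also have "\<dots> = sqrt (real (k + 1)) * sqrt (\<Sum>i\<in>UNIV. \<Sum>j\<le>k. (d j $ i)\<^sup>2)"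
    by (simp only: norm_sq real_sqrt_mult mult.commute)
  also have "sqrt (\<Sum>i\<in>UNIV. \<Sum>j\<le>k. (d j $ i)\<^sup>2) \<le> (\<Sum>i\<in>UNIV. sqrt (\<Sum>j\<le>k. (d j $ i)\<^sup>2))"
  proof -
    have "L2_set (\<lambda>i. sqrt (\<Sum>j\<le>k. (d j $ i)\<^sup>2)) UNIV
        \<le> (\<Sum>i\<in>UNIV. sqrt (\<Sum>j\<le>k. (d j $ i)\<^sup>2))"
      by (intro L2_set_le_sum) (simp add: sum_nonneg)
    then show ?thesis
      by (simp add: L2_set_def sum_nonneg)
  qed
  finally show ?thesis
    by (simp add: mult_left_mono)
qed


section \<open>A single realization\<close>

text \<open>
  The random part of the argument needs only facts about one outcome at a time, so these are
  collected for a fixed realization of the algorithm.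
\<close>

locale adagb2_realization =
  fixes f :: "real ^ 'n \<Rightarrow> real"
    and l u :: "ereal ^ 'n" and xini :: "real ^ 'n"
    and varsigma \<tau> \<kappa>s L \<kappa>B flow :: real
    and x g d w \<Delta> s :: "nat \<Rightarrow> real ^ 'n" and B :: "nat \<Rightarrow> real ^ 'n ^ 'n"
  assumes params: "0 < varsigma" "varsigma \<le> 1" "0 < \<tau>" "\<tau> \<le> 1" "1 \<le> \<kappa>s"
    and run: "adagb2_run varsigma \<tau> \<kappa>s l u xini x g d w \<Delta> B s"
    and nonempty: "feasible_box l u \<noteq> {}"
    and gradient: "\<And>y. y \<in> feasible_box l u \<Longrightarrow> GDERIV f y :> gradient f y"
    and lipschitz: "\<And>y z. norm (gradient f y - gradient f z) \<le> L * norm (y - z)"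
    and \<kappa>B_ge: "1 \<le> \<kappa>B"
    and B_bound: "\<And>j. onorm (\<lambda>v. B j *v v) \<le> \<kappa>B"
    and flow_bound: "\<And>y. y \<in> feasible_box l u \<Longrightarrow> flow \<le> f y"
begin

abbreviation "F \<equiv> feasible_box l u"

definition "decrease_rate = \<tau> * sqrt varsigma / (2 * \<kappa>B)"

lemma decrease_rate_pos: "0 < decrease_rate"
  using params \<kappa>B_ge by (simp add: decrease_rate_def)

lemma
  shows x_0: "x 0 = closest_point F xini"
    and d_eq: "d j = closest_point F (x j - g j) - x j"
    and \<Delta>_eq: "\<Delta> j $ i = \<bar>d j $ i\<bar> / w j $ i"
    and trial_feasible: "x j + s j \<in> F"
    and s_le: "\<bar>s j $ i\<bar> \<le> \<kappa>s * \<Delta> j $ i"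
    and sufficient_decrease: "quad_model (g j) (B j) (s j)
      \<le> \<tau> * quad_model (g j) (B j) (quadratic_step F (x j) (g j) (\<Delta> j) (B j))"
    and x_Suc: "x (Suc j) = x j + s j"
  using run unfolding adagb2_run_def by blast+

lemma iterate_feasible: "x j \<in> F"
  by (cases j)
    (use x_0 x_Suc trial_feasible nonempty in
      \<open>auto simp: closest_point_in_set feasible_box_closed\<close>)

lemma weight_rec:
  "w k $ i = sqrt ((case k of 0 \<Rightarrow> sqrt varsigma | Suc j \<Rightarrow> w j $ i)\<^sup>2 + (d k $ i)\<^sup>2)"
  using run unfolding adagb2_run_def by blast

lemma weight_sq: "(w k $ i)\<^sup>2 = varsigma + (\<Sum>j\<le>k. (d j $ i)\<^sup>2)"
proof (induction k)
  case 0
  show ?case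
    using params by (subst weight_rec) simp
next
  case (Suc k)
  have "(w (Suc k) $ i)\<^sup>2 = (w k $ i)\<^sup>2 + (d (Suc k) $ i)\<^sup>2"
    by (subst weight_rec) simp
  then show ?case
    using Suc by simp
qed

lemma weight_nonneg: "0 \<le> w k $ i"
  by (subst weight_rec) simp

lemma weight_ge: "sqrt varsigma \<le> w k $ i"
proof (rule real_le_lsqrt)
  show "varsigma \<le> (w k $ i)\<^sup>2"
    by (simp add: weight_sq sum_nonneg)
qed (rule weight_nonneg)

lemma weight_pos: "0 < w k $ i"
  using weight_ge[of k i] params by (meson less_le_trans real_sqrt_gt_zero)

lemma weight_mono: "j \<le> k \<Longrightarrow> w j $ i \<le> w k $ i"
proof (rule power2_le_imp_le[OF _ weight_nonneg])
  assume "j \<le> k"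
  then show "(w j $ i)\<^sup>2 \<le> (w k $ i)\<^sup>2"
    unfolding weight_sq by (intro add_left_mono sum_mono2) auto
qed

lemma \<Delta>_nonneg: "0 \<le> \<Delta> j $ i"
  by (simp add: \<Delta>_eq weight_nonneg)

lemma \<Delta>_le_1: "\<Delta> j $ i \<le> 1"
proof -
  have "(d j $ i)\<^sup>2 \<le> (\<Sum>m\<le>j. (d m $ i)\<^sup>2)"
    by (rule member_le_sum) auto
  then have "\<bar>d j $ i\<bar>\<^sup>2 \<le> (w j $ i)\<^sup>2"
    unfolding weight_sq using params by simp
  then have "\<bar>d j $ i\<bar> \<le> w j $ i"
    using weight_nonneg by (rule power2_le_imp_le)
  then show ?thesis
    by (simp add: \<Delta>_eq weight_pos divide_le_eq)
qed

lemma step_norm_sq: "(norm (s j))\<^sup>2 \<le> \<kappa>s\<^sup>2 * (\<Sum>i\<in>UNIV. (\<Delta> j $ i)\<^sup>2)"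
proof -
  have "(norm (s j))\<^sup>2 = (\<Sum>i\<in>UNIV. (s j $ i)\<^sup>2)"
    by (simp add: norm_vec_def L2_set_def sum_nonneg)
  also have "\<dots> \<le> (\<Sum>i\<in>UNIV. (\<kappa>s * \<Delta> j $ i)\<^sup>2)"
  proof (rule sum_mono)
    fix i
    show "(s j $ i)\<^sup>2 \<le> (\<kappa>s * \<Delta> j $ i)\<^sup>2"
      using s_le[of j i] by (simp add: power2_le_iff_abs_le order_trans[OF abs_ge_zero])
  qed
  finally show ?thesis
    by (simp add: power_mult_distrib sum_distrib_left)
qed

lemma step_norm_sq_bounded: "(norm (s j))\<^sup>2 \<le> \<kappa>s\<^sup>2 * real CARD('n)"
proof -
  have "(\<Sum>i\<in>UNIV. (\<Delta> j $ i)\<^sup>2) \<le> (\<Sum>i\<in>(UNIV :: 'n set). 1)"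
    using \<Delta>_nonneg \<Delta>_le_1 by (intro sum_mono) (simp add: power_le_one)
  then have "\<kappa>s\<^sup>2 * (\<Sum>i\<in>UNIV. (\<Delta> j $ i)\<^sup>2) \<le> \<kappa>s\<^sup>2 * real CARD('n)"
    by (intro mult_left_mono) auto
  then show ?thesis
    using step_norm_sq[of j] by linarith
qed

lemma projected_gradient_opposed: "g j $ i * d j $ i + (d j $ i)\<^sup>2 \<le> 0"
proof -
  have "((x j - g j) $ i - closest_point F (x j - g j) $ i)
      * (x j $ i - closest_point F (x j - g j) $ i) \<le> 0"
    by (rule closest_point_box_coordinate
        [OF ereal_interval_convex ereal_interval_closed feasible_box_as_box nonempty])
      (use iterate_feasible[of j] in \<open>simp add: feasible_box_def\<close>)
  then show ?thesis
    by (simp add: d_eq algebra_simps power2_eq_square)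
qed

text \<open>
  The half-width of the trust region is \<open>1 / w\<close> times the length of the projected gradient
  step, but \<open>w\<close> may lie below 1, and then \<open>1 / w\<close> times that step can leave the feasible box.
  The multiple \<open>sqrt varsigma / w \<le> 1\<close> of \<open>d\<close> is a feasible competitor in every case.
\<close>

lemma linear_step_component:
  defines "\<sigma> \<equiv> \<lambda>j. linear_step F (x j) (g j) (\<Delta> j)"
  shows "(\<sigma> j $ i)\<^sup>2 \<le> - (g j $ i * \<sigma> j $ i)"
    and "g j $ i * \<sigma> j $ i \<le> - (sqrt varsigma * ((d j $ i)\<^sup>2 / w j $ i))"
proof -
  define I where "I m = {t. l $ m \<le> ereal t \<and> ereal t \<le> u $ m} \<inter> cball (x j $ m) (\<Delta> j $ m)" for m
  define S where "S = F \<inter> trust_box (x j) (\<Delta> j)"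
  have S: "S = {y. \<forall>m. y $ m \<in> I m}"
    by (auto simp: S_def I_def feasible_box_def trust_box_def dist_real_def abs_minus_commute)
  have conv: "convex (I m)" and clos: "closed (I m)" for m
    unfolding I_def
    by (auto intro!: convex_Int closed_Int ereal_interval_convex ereal_interval_closed)
  have xI: "x j $ m \<in> I m" for m
    using iterate_feasible[of j] \<Delta>_nonneg[of j m] by (simp add: I_def feasible_box_def)
  then have ne: "S \<noteq> {}"
    unfolding S by blast
  have vi: "(- g j $ i - \<sigma> j $ i) * (t - \<sigma> j $ i) \<le> 0" if "x j $ i + t \<in> I i" for t
    using closest_point_box_coordinate[OF conv clos S ne that, where a = "x j - g j"]
    by (simp add: \<sigma>_def linear_step_def S_def algebra_simps)
  show "(\<sigma> j $ i)\<^sup>2 \<le> - (g j $ i * \<sigma> j $ i)"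
    using vi[of 0] xI by (simp add: algebra_simps power2_eq_square)
  define \<theta> where "\<theta> = sqrt varsigma / w j $ i"
  have \<theta>: "0 \<le> \<theta>" "\<theta> \<le> 1"
    using params weight_ge[of j i] weight_pos[of j i] by (auto simp: \<theta>_def divide_le_eq)
  have "x j $ i + \<theta> * d j $ i \<in> {t. l $ i \<le> ereal t \<and> ereal t \<le> u $ i}"
  proof -
    have "x j + d j \<in> F"
      by (simp add: d_eq closest_point_in_set feasible_box_closed nonempty)
    then have "(1 - \<theta>) *\<^sub>R x j + \<theta> *\<^sub>R (x j + d j) \<in> F"
      using iterate_feasible[of j] \<theta> by (intro convexD feasible_box_convex) auto
    then have "((1 - \<theta>) *\<^sub>R x j + \<theta> *\<^sub>R (x j + d j)) $ i
        \<in> {t. l $ i \<le> ereal t \<and> ereal t \<le> u $ i}"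
      unfolding feasible_box_def by blast
    then show ?thesis
      by (simp add: algebra_simps)
  qed
  moreover have "\<bar>\<theta> * d j $ i\<bar> \<le> \<Delta> j $ i"
  proof -
    have "\<bar>\<theta> * d j $ i\<bar> = sqrt varsigma * \<Delta> j $ i"
      using params weight_nonneg[of j i] by (simp add: \<theta>_def \<Delta>_eq abs_mult)
    also have "\<dots> \<le> \<Delta> j $ i"
      using params \<Delta>_nonneg[of j i] by (intro mult_left_le_one_le) auto
    finally show ?thesis .
  qed
  ultimately have "x j $ i + \<theta> * d j $ i \<in> I i"
    by (simp add: I_def dist_real_def)
  then have "g j $ i * \<sigma> j $ i \<le> - (\<theta> * (d j $ i)\<^sup>2)"
    by (intro projected_component_decrease \<theta> projected_gradient_opposed vi)
  then show "g j $ i * \<sigma> j $ i \<le> - (sqrt varsigma * ((d j $ i)\<^sup>2 / w j $ i))"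
    by (simp add: \<theta>_def)
qed

lemma curvature_le: "v \<bullet> (B j *v v) \<le> \<kappa>B * (norm v)\<^sup>2"
proof -
  have "v \<bullet> (B j *v v) \<le> norm v * norm (B j *v v)"
    by (rule norm_cauchy_schwarz)
  also have "norm (B j *v v) \<le> onorm (\<lambda>v. B j *v v) * norm v"
    by (rule onorm) simp
  also have "onorm (\<lambda>v. B j *v v) * norm v \<le> \<kappa>B * norm v"
    by (intro mult_right_mono B_bound) simp
  finally show ?thesis
    by (simp add: mult_left_mono power2_eq_square mult.left_commute)
qed

lemma curvature_ge: "- (\<kappa>B * (norm v)\<^sup>2) \<le> v \<bullet> (B j *v v)"
proof -
  have "- (v \<bullet> (B j *v v)) \<le> norm v * norm (B j *v v)"
    using Cauchy_Schwarz_ineq2[of v "B j *v v"] by linarith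
  also have "norm (B j *v v) \<le> onorm (\<lambda>v. B j *v v) * norm v"
    by (rule onorm) simp
  also have "onorm (\<lambda>v. B j *v v) * norm v \<le> \<kappa>B * norm v"
    by (intro mult_right_mono B_bound) simp
  finally have "- (v \<bullet> (B j *v v)) \<le> \<kappa>B * (norm v)\<^sup>2"
    by (simp add: mult_left_mono power2_eq_square mult.left_commute)
  then show ?thesis
    by linarith
qed

text \<open>
  \<open>decrease_rate\<close> collects the three losses on the way to the actual step: the factor
  \<open>sqrt varsigma\<close> of the linear step, the factor \<open>1 / (2 * \<kappa>B)\<close> of its scaling, and the
  factor \<open>\<tau>\<close> of the inexact model minimization.
\<close>

lemma model_decrease:
  "quad_model (g j) (B j) (s j) \<le> - (decrease_rate * (\<Sum>i\<in>UNIV. (d j $ i)\<^sup>2 / w j $ i))"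
proof -
  define \<sigma> where "\<sigma> = linear_step F (x j) (g j) (\<Delta> j)"
  have "(norm \<sigma>)\<^sup>2 = (\<Sum>i\<in>UNIV. (\<sigma> $ i)\<^sup>2)"
    by (simp add: norm_vec_def L2_set_def sum_nonneg)
  also have "\<dots> \<le> (\<Sum>i\<in>UNIV. - (g j $ i * \<sigma> $ i))"
    unfolding \<sigma>_def by (intro sum_mono linear_step_component)
  also have "\<dots> = - (g j \<bullet> \<sigma>)"
    by (simp add: inner_vec_def sum_negf)
  finally have dec: "(norm \<sigma>)\<^sup>2 \<le> - (g j \<bullet> \<sigma>)" .
  have "g j \<bullet> \<sigma> \<le> (\<Sum>i\<in>UNIV. - (sqrt varsigma * ((d j $ i)\<^sup>2 / w j $ i)))"
    unfolding inner_vec_def inner_real_def \<sigma>_def by (intro sum_mono linear_step_component)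
  also have "\<dots> = - (sqrt varsigma * (\<Sum>i\<in>UNIV. (d j $ i)\<^sup>2 / w j $ i))"
    by (simp only: sum_negf sum_distrib_left)
  finally have lin: "g j \<bullet> \<sigma> \<le> - (sqrt varsigma * (\<Sum>i\<in>UNIV. (d j $ i)\<^sup>2 / w j $ i))" .
  have "quad_model (g j) (B j) (s j)
      \<le> \<tau> * quad_model (g j) (B j) (step_scaling (g j) (B j) \<sigma> *\<^sub>R \<sigma>)"
    using sufficient_decrease[of j] by (simp add: quadratic_step_def Let_def \<sigma>_def)
  also have "\<dots> \<le> \<tau> * ((g j \<bullet> \<sigma>) / (2 * \<kappa>B))"
    using params by (intro mult_left_mono quad_model_scaled_step dec curvature_le \<kappa>B_ge) auto
  also have "\<dots> \<le> \<tau> * (- (sqrt varsigma * (\<Sum>i\<in>UNIV. (d j $ i)\<^sup>2 / w j $ i)) / (2 * \<kappa>B))"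
    using params \<kappa>B_ge lin by (intro mult_left_mono divide_right_mono) auto
  finally show ?thesis
    by (simp add: decrease_rate_def)
qed

text \<open>
  The model differs from the Taylor expansion of \<open>f\<close> in the gradient and in the curvature.
  The curvature may be negative, which is why \<open>\<kappa>B\<close> joins \<open>L\<close> in the last term.
\<close>

lemma objective_decrease:
  "f (x (Suc j)) \<le> f (x j) - decrease_rate * (\<Sum>i\<in>UNIV. (d j $ i)\<^sup>2 / w j $ i)
     + \<bar>(gradient f (x j) - g j) \<bullet> s j\<bar> + (\<kappa>B + L) / 2 * (norm (s j))\<^sup>2"
proof -
  have "f (x j + s j) \<le> f (x j) + gradient f (x j) \<bullet> s j + L / 2 * (norm (s j))\<^sup>2"
    using iterate_feasible trial_feasible
    by (intro lipschitz_gradient_descent[OF feasible_box_convex] gradient lipschitz) auto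
  moreover have "gradient f (x j) \<bullet> s j
      = quad_model (g j) (B j) (s j) - 1 / 2 * (s j \<bullet> (B j *v s j))
        + (gradient f (x j) - g j) \<bullet> s j"
    by (simp add: quad_model_def inner_diff_left)
  moreover have "(gradient f (x j) - g j) \<bullet> s j \<le> \<bar>(gradient f (x j) - g j) \<bullet> s j\<bar>"
    by simp
  moreover have "(\<kappa>B + L) / 2 * (norm (s j))\<^sup>2
      = 1 / 2 * (\<kappa>B * (norm (s j))\<^sup>2) + L / 2 * (norm (s j))\<^sup>2"
    by (simp add: algebra_simps add_divide_distrib)
  ultimately show ?thesis
    using model_decrease[of j] curvature_ge[of "s j" j] unfolding x_Suc by linarith
qed

text \<open>
  By the recursion of the weights, \<open>\<Delta>\<^sup>2\<close> is the relative increment of \<open>w\<^sup>2\<close>, so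
  its sum is controlled by the logarithm of the total growth.
\<close>

lemma sum_step_norm_sq:
  "(\<Sum>j\<le>k. (norm (s j))\<^sup>2) \<le> \<kappa>s\<^sup>2 * (\<Sum>i\<in>UNIV. ln ((w k $ i)\<^sup>2 / varsigma))"
proof -
  have log: "(\<Sum>j\<le>k. (\<Delta> j $ i)\<^sup>2) \<le> ln ((w k $ i)\<^sup>2 / varsigma)" for i
  proof -
    (* The index shift puts the initial value varsigma at position 0. *)
    define v where "v j = varsigma + (\<Sum>m<j. (d m $ i)\<^sup>2)" for j
    have v: "v 0 = varsigma" "v (Suc j) = (w j $ i)\<^sup>2" "(w j $ i)\<^sup>2 - v j = (d j $ i)\<^sup>2" for j
      by (simp_all add: v_def weight_sq lessThan_Suc_atMost[symmetric])
    have "(\<Sum>j\<le>k. (v (Suc j) - v j) / v (Suc j)) \<le> ln (v (Suc k) / v 0)"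
      by (rule sum_quotient_le_ln) (use params in \<open>auto simp: v_def\<close>)
    then show ?thesis
      by (simp add: v \<Delta>_eq power_divide)
  qed
  have "(\<Sum>j\<le>k. (norm (s j))\<^sup>2) \<le> (\<Sum>j\<le>k. \<kappa>s\<^sup>2 * (\<Sum>i\<in>UNIV. (\<Delta> j $ i)\<^sup>2))"
    by (intro sum_mono step_norm_sq)
  also have "\<dots> = \<kappa>s\<^sup>2 * (\<Sum>i\<in>UNIV. \<Sum>j\<le>k. (\<Delta> j $ i)\<^sup>2)"
    by (subst sum.swap) (simp only: sum_distrib_left)
  also have "\<dots> \<le> \<kappa>s\<^sup>2 * (\<Sum>i\<in>UNIV. ln ((w k $ i)\<^sup>2 / varsigma))"
    by (intro mult_left_mono sum_mono log) auto
  finally show ?thesis .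
qed

text \<open>
  Replacing all weights by the last and largest one bounds the sum from below by
  \<open>(w\<^sup>2 - varsigma) / w\<close>; there \<open>varsigma / w \<le> sqrt varsigma\<close>.
\<close>

lemma weight_le_sum_quotient:
  "w k $ i - sqrt varsigma \<le> (\<Sum>j\<le>k. (d j $ i)\<^sup>2 / w j $ i)"
proof -
  have "varsigma / w k $ i \<le> sqrt varsigma"
    using params weight_ge[of k i] weight_pos[of k i]
    by (simp add: divide_le_eq)
      (metis less_imp_le mult_left_mono real_sqrt_ge_zero real_sqrt_mult_self abs_of_pos)
  moreover have "(\<Sum>j\<le>k. (d j $ i)\<^sup>2) / w k $ i = w k $ i - varsigma / w k $ i"
    using weight_sq[of k i] weight_pos[of k i] by (simp add: field_simps power2_eq_square)
  moreover have "(\<Sum>j\<le>k. (d j $ i)\<^sup>2) / w k $ i \<le> (\<Sum>j\<le>k. (d j $ i)\<^sup>2 / w j $ i)"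
    unfolding sum_divide_distrib
    by (intro sum_mono divide_left_mono weight_mono mult_pos_pos weight_pos) auto
  ultimately show ?thesis
    by linarith
qed

lemma sum_weights_le:
  "decrease_rate * (\<Sum>i\<in>UNIV. w k $ i)
     \<le> decrease_rate * (real CARD('n) * sqrt varsigma) + (f (closest_point F xini) - flow)
     + (\<Sum>j\<le>k. \<bar>(gradient f (x j) - g j) \<bullet> s j\<bar>) + (\<kappa>B + L) / 2 * (\<Sum>j\<le>k. (norm (s j))\<^sup>2)"
proof -
  have telescope: "f (x (Suc k))
      \<le> f (x 0) - decrease_rate * (\<Sum>j\<le>k. \<Sum>i\<in>UNIV. (d j $ i)\<^sup>2 / w j $ i)
      + (\<Sum>j\<le>k. \<bar>(gradient f (x j) - g j) \<bullet> s j\<bar>) + (\<kappa>B + L) / 2 * (\<Sum>j\<le>k. (norm (s j))\<^sup>2)"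
  proof (induction k)
    case 0
    then show ?case
      using objective_decrease[of 0] by simp
  next
    case (Suc k)
    then show ?case
      using objective_decrease[of "Suc k"] by (simp add: algebra_simps)
  qed
  have "(\<Sum>i\<in>UNIV. w k $ i) - real CARD('n) * sqrt varsigma
      = (\<Sum>i\<in>UNIV. w k $ i - sqrt varsigma)"
    by (simp add: sum_subtractf)
  also have "\<dots> \<le> (\<Sum>i\<in>UNIV. \<Sum>j\<le>k. (d j $ i)\<^sup>2 / w j $ i)"
    by (intro sum_mono weight_le_sum_quotient)
  also have "\<dots> = (\<Sum>j\<le>k. \<Sum>i\<in>UNIV. (d j $ i)\<^sup>2 / w j $ i)"
    by (rule sum.swap)
  finally have "decrease_rate * ((\<Sum>i\<in>UNIV. w k $ i) - real CARD('n) * sqrt varsigma)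
      \<le> decrease_rate * (\<Sum>j\<le>k. \<Sum>i\<in>UNIV. (d j $ i)\<^sup>2 / w j $ i)"
    using decrease_rate_pos by (intro mult_left_mono) auto
  then show ?thesis
    using telescope flow_bound[OF iterate_feasible[of "Suc k"]]
    unfolding x_0 right_diff_distrib by linarith
qed

text \<open>
  \<open>R\<close> stands for the total factor with which the squared step norms enter the expected
  objective decrease. The tangent slope is half of the \<open>decrease_rate\<close> in \<open>sum_weights_le\<close>,
  so that half of the linear term there survives.
\<close>

lemma sum_step_norm_sq_le_weights:
  assumes "0 < R"
  shows "R * (\<Sum>j\<le>k. (norm (s j))\<^sup>2) \<le> decrease_rate / 2 * (\<Sum>i\<in>UNIV. w k $ i)
     + real CARD('n)
       * (2 * (\<kappa>s\<^sup>2 * R) * (ln (4 * (\<kappa>s\<^sup>2 * R) / (decrease_rate * sqrt varsigma)) - 1))"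
proof -
  define C where "C = 2 * (\<kappa>s\<^sup>2 * R)
    * (ln (4 * (\<kappa>s\<^sup>2 * R) / (decrease_rate * sqrt varsigma)) - 1)"
  have "R * (\<Sum>j\<le>k. (norm (s j))\<^sup>2) \<le> R * (\<kappa>s\<^sup>2 * (\<Sum>i\<in>UNIV. ln ((w k $ i)\<^sup>2 / varsigma)))"
    using assms by (intro mult_left_mono sum_step_norm_sq) auto
  also have "\<dots> = (\<Sum>i\<in>UNIV. (\<kappa>s\<^sup>2 * R) * ln ((w k $ i)\<^sup>2 / (sqrt varsigma)\<^sup>2))"
    using params by (simp add: sum_distrib_left mult.assoc mult.left_commute)
  also have "\<dots> \<le> (\<Sum>i\<in>UNIV. decrease_rate / 2 * w k $ i + C)"
    unfolding C_def using assms params decrease_rate_pos weight_pos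
    by (intro sum_mono ln_ratio_tangent mult_pos_pos) auto
  also have "\<dots> = decrease_rate / 2 * (\<Sum>i\<in>UNIV. w k $ i) + real CARD('n) * C"
    by (simp add: sum.distrib sum_distrib_left)
  finally show ?thesis
    unfolding C_def .
qed

lemma sum_norm_le_weights:
  "(\<Sum>j\<le>k. norm (d j)) \<le> sqrt (real (k + 1)) * (\<Sum>i\<in>UNIV. w k $ i)"
proof -
  have "sqrt (\<Sum>j\<le>k. (d j $ i)\<^sup>2) \<le> w k $ i" for i
  proof (rule real_le_lsqrt)
    show "(\<Sum>j\<le>k. (d j $ i)\<^sup>2) \<le> (w k $ i)\<^sup>2"
      using params by (simp add: weight_sq)
  qed (rule weight_nonneg)
  then have "sqrt (real (k + 1)) * (\<Sum>i\<in>UNIV. sqrt (\<Sum>j\<le>k. (d j $ i)\<^sup>2))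
      \<le> sqrt (real (k + 1)) * (\<Sum>i\<in>UNIV. w k $ i)"
    by (intro mult_left_mono sum_mono) auto
  then show ?thesis
    using sum_norm_le_sqrt_sum[of d k] by linarith
qed

end


section \<open>Expectations\<close>

lemma past_subalgebra:
  assumes "\<And>j. g j \<in> borel_measurable M"
  shows "subalgebra M (past_algebra M g k)"
proof -
  have "{g j -` A \<inter> space M | j A. j < k \<and> A \<in> sets borel} \<subseteq> sets M"
    using assms by (auto intro: measurable_sets)
  then show ?thesis
    unfolding subalgebra_def past_algebra_def
    by (simp add: space_measure_of_conv sets_measure_of_conv sets.sigma_sets_subset)
qed

text \<open>
  The conditional expectations are of nonnegative extended reals, where no integrability is
  presupposed; integrating them out therefore also yields the integrability of \<open>e\<close>.
\<close>

lemma expectation_le_if_cond_exp_le: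
  fixes e q :: "'a \<Rightarrow> real"
  assumes M: "prob_space M" and sub: "subalgebra M N"
    and e: "e \<in> borel_measurable M" "\<And>\<omega>. 0 \<le> e \<omega>"
    and q: "integrable M q" "\<And>\<omega>. 0 \<le> q \<omega>" and a: "0 \<le> a"
    and le: "AE \<omega> in M. nn_cond_exp M N (\<lambda>\<omega>. ennreal (e \<omega>)) \<omega>
      \<le> ennreal a * nn_cond_exp M N (\<lambda>\<omega>. ennreal (q \<omega>)) \<omega>"
  shows "integrable M e" and "integral\<^sup>L M e \<le> a * integral\<^sup>L M q"
proof -
  interpret prob_space M by (rule M)
  interpret finite_measure_subalgebra M N
    by unfold_locales (rule sub)
  have q_meas [measurable]: "q \<in> borel_measurable M"
    using q(1) by simp
  note e(1) [measurable]
  have intg: "(\<integral>\<^sup>+\<omega>. nn_cond_exp M N h \<omega> \<partial>M) = (\<integral>\<^sup>+\<omega>. h \<omega> \<partial>M)"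
    if "h \<in> borel_measurable M" for h
    using nn_cond_exp_intg[of "\<lambda>_. 1" h] that by simp
  have "(\<integral>\<^sup>+\<omega>. ennreal (e \<omega>) \<partial>M) = (\<integral>\<^sup>+\<omega>. nn_cond_exp M N (\<lambda>\<omega>. ennreal (e \<omega>)) \<omega> \<partial>M)"
    by (simp add: intg)
  also have "\<dots> \<le> (\<integral>\<^sup>+\<omega>. ennreal a * nn_cond_exp M N (\<lambda>\<omega>. ennreal (q \<omega>)) \<omega> \<partial>M)"
    using le by (rule nn_integral_mono_AE)
  also have "\<dots> = ennreal a * (\<integral>\<^sup>+\<omega>. ennreal (q \<omega>) \<partial>M)"
    by (subst nn_integral_cmult) (auto simp: intg intro!: measurable_from_subalg[OF subalg])
  also have "\<dots> = ennreal (a * integral\<^sup>L M q)"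
    using q a by (simp add: nn_integral_eq_integral ennreal_mult)
  finally have le': "(\<integral>\<^sup>+\<omega>. ennreal (e \<omega>) \<partial>M) \<le> ennreal (a * integral\<^sup>L M q)" .
  then have "(\<integral>\<^sup>+\<omega>. ennreal (e \<omega>) \<partial>M) < \<infinity>"
    using le_less_trans by fastforce
  then show int: "integrable M e"
    using e by (intro integrableI_nonneg) auto
  show "integral\<^sup>L M e \<le> a * integral\<^sup>L M q"
  proof -
    have "ennreal (integral\<^sup>L M e) \<le> ennreal (a * integral\<^sup>L M q)"
      using le' int e by (simp add: nn_integral_eq_integral)
    then show ?thesis
      using a q by (simp add: ennreal_le_iff)
  qed
qed

text \<open>
  Passing to the stated constant costs a bound \<open>n\<close> for the contribution of the initial
  weights, which is absorbed by the additional factor \<open>n\<close> in the logarithm and the additional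
  1, as \<open>2 * n * K * ln n \<ge> n * ln n \<ge> n - 1\<close>.
\<close>

lemma le_kappa_conv:
  fixes n :: nat and varsigma \<tau> \<kappa>B K \<Gamma>0 W c :: real
  assumes vs: "0 < varsigma" "varsigma \<le> 1" and \<tau>: "0 < \<tau>" "\<tau> \<le> 1" and \<kappa>B: "1 \<le> \<kappa>B"
    and K: "1 / 2 \<le> K" and n: "1 \<le> n" and W: "0 \<le> W"
    and c: "c = \<tau> * sqrt varsigma / (2 * \<kappa>B)"
    and le: "c / 2 * W \<le> c * (real n * sqrt varsigma) + \<Gamma>0
      + real n * (2 * K * (ln (4 * K / (c * sqrt varsigma)) - 1))"
  shows "W \<le> kappa_conv n varsigma \<tau> \<kappa>B K \<Gamma>0"
proof -
  define A where "A = 8 * K * \<kappa>B / (\<tau> * varsigma)"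
  define A' where "A' = 8 * real n * K * \<kappa>B / (\<tau> * varsigma powr (5/2))"
  define D where "D = 1 + \<Gamma>0 + 2 * real n * K * (ln A' - 1)"
  have c_vs: "c * sqrt varsigma = \<tau> * varsigma / (2 * \<kappa>B)"
    using vs by (simp add: c)
  have A: "4 * K / (c * sqrt varsigma) = A"
    unfolding c_vs A_def using vs \<tau> \<kappa>B by (simp add: field_simps)
  have A_pos: "0 < A"
    unfolding A_def using vs \<tau> \<kappa>B K by (intro divide_pos_pos mult_pos_pos) auto
  have "varsigma powr (5/2) \<le> varsigma powr 1"
    using vs by (intro powr_mono') auto
  then have "\<tau> * varsigma powr (5/2) \<le> \<tau> * varsigma"
    using vs \<tau> by simp
  then have "real n * A \<le> A'"
    unfolding A_def A'_def times_divide_eq_right using vs \<tau> \<kappa>B K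
    by (intro frac_le) auto
  then have "ln (real n * A) \<le> ln A'"
    using A_pos n by (intro ln_mono) auto
  then have ln_A': "ln (real n) + ln A \<le> ln A'"
    using A_pos n by (simp add: ln_mult)
  have "ln (1 / real n) \<le> 1 / real n - 1"
    using n by (intro ln_le_minus_one) simp
  then have "1 - 1 / real n \<le> ln (real n)"
    using n by (simp add: ln_div)
  then have "real n * (1 - 1 / real n) \<le> real n * ln (real n)"
    by (intro mult_left_mono) auto
  then have n_ln_n: "real n - 1 \<le> real n * ln (real n)"
    using n by (simp add: right_diff_distrib)
  also have "\<dots> \<le> 2 * K * (real n * ln (real n))"
    using n K mult_right_mono[of 1 "2 * K" "real n * ln (real n)"] by simp
  also have "\<dots> = 2 * real n * K * ln (real n)"
    by simp
  finally have absorb: "real n - 1 \<le> 2 * real n * K * ln (real n)" .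
  have "2 * real n * K * (ln (real n) + ln A - 1) \<le> 2 * real n * K * (ln A' - 1)"
    using ln_A' K by (intro mult_left_mono) auto
  then have "2 * real n * K * ln (real n) + 2 * real n * K * (ln A - 1) \<le> 2 * real n * K * (ln A' - 1)"
    by (simp add: algebra_simps)
  moreover have "c * (real n * sqrt varsigma) \<le> real n"
  proof -
    have "\<tau> * varsigma \<le> 1"
      using vs \<tau> by (simp add: mult_le_one)
    then have "\<tau> * varsigma / (2 * \<kappa>B) \<le> 1"
      using \<kappa>B by (simp add: divide_le_eq)
    then have "real n * (c * sqrt varsigma) \<le> real n * 1"
      unfolding c_vs by (intro mult_left_mono) auto
    then show ?thesis
      by (simp add: mult.left_commute)
  qed
  ultimately have D: "c / 2 * W \<le> D"
    using le[unfolded A mult.left_commute[of "real n"]] absorb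
    unfolding D_def by (simp add: algebra_simps)
  have c_pos: "0 < c"
    using vs \<tau> \<kappa>B by (simp add: c)
  then have "0 \<le> D"
    using D W by (smt (verit) mult_nonneg_nonneg half_gt_zero)
  have "W \<le> 2 / c * D"
    using D c_pos by (simp add: field_simps)
  also have "2 / c = 4 * \<kappa>B / (\<tau> * sqrt varsigma)"
    using \<kappa>B \<tau> vs by (simp add: c field_simps)
  also have "4 * \<kappa>B / (\<tau> * sqrt varsigma) * D \<le> 4 * \<kappa>B / (\<tau> * varsigma\<^sup>2) * D"
  proof (rule mult_right_mono)
    have "varsigma\<^sup>2 \<le> varsigma * 1"
      unfolding power2_eq_square using vs by (intro mult_left_mono) auto
    also have "varsigma * 1 \<le> sqrt varsigma"
      using vs by (intro real_le_rsqrt) (simp add: power2_eq_square mult_left_le_one_le)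
    finally show "4 * \<kappa>B / (\<tau> * sqrt varsigma) \<le> 4 * \<kappa>B / (\<tau> * varsigma\<^sup>2)"
      using vs \<tau> \<kappa>B by (intro divide_left_mono mult_left_mono mult_pos_pos) auto
  qed (rule \<open>0 \<le> D\<close>)
  finally show ?thesis
    by (simp add: kappa_conv_def D_def A'_def)
qed

theorem theorem3p4:
  fixes f :: "real ^ 'n \<Rightarrow> real" and U :: "(real ^ 'n) set"
    and l u :: "ereal ^ 'n" and xini :: "real ^ 'n"
    and varsigma \<tau> \<kappa>s L \<kappa>B flow \<kappa>Gg :: real
    and M :: "'a measure"
    and x g d w \<Delta> s :: "nat \<Rightarrow> 'a \<Rightarrow> real ^ 'n"
    and B :: "nat \<Rightarrow> 'a \<Rightarrow> real ^ 'n ^ 'n"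
    and k :: nat
  assumes prob: "prob_space M"
    and params: "0 < varsigma" "varsigma \<le> 1" "0 < \<tau>" "\<tau> \<le> 1" "1 \<le> \<kappa>s"
    \<comment> \<open>measurability; the iterate is determined by the past\<close>
    and meas: "\<And>j. g j \<in> borel_measurable M" "\<And>j. d j \<in> borel_measurable M"
      "\<And>j. w j \<in> borel_measurable M" "\<And>j. \<Delta> j \<in> borel_measurable M"
      "\<And>j. B j \<in> borel_measurable M" "\<And>j. s j \<in> borel_measurable M"
    and adapted: "\<And>j. x j \<in> borel_measurable (past_algebra M g j)"
    and algorithm: "AE \<omega> in M. adagb2_run varsigma \<tau> \<kappa>s l u xini
      (\<lambda>j. x j \<omega>) (\<lambda>j. g j \<omega>) (\<lambda>j. d j \<omega>) (\<lambda>j. w j \<omega>) (\<lambda>j. \<Delta> j \<omega>) (\<lambda>j. B j \<omega>) (\<lambda>j. s j \<omega>)"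
    and domain: "open U" "feasible_box l u \<subseteq> U"
    and smooth: "twice_continuously_differentiable_on f U"
    and nonempty: "feasible_box l u \<noteq> {}"
    and diff: "\<And>y. f differentiable (at y)"
    and L_nonneg: "0 \<le> L"
    and lipschitz: "\<And>y z. norm (gradient f y - gradient f z) \<le> L * norm (y - z)"
    and \<kappa>B_ge: "1 \<le> \<kappa>B"
    and B_bound: "AE \<omega> in M. \<forall>j. onorm (\<lambda>v. B j \<omega> *v v) \<le> \<kappa>B"
    and flow_less: "flow < f (closest_point (feasible_box l u) xini)"
    and flow_bound: "\<And>y. y \<in> feasible_box l u \<Longrightarrow> flow \<le> f y"
    and \<kappa>Gg_pos: "0 < \<kappa>Gg"
    and error_bound: "\<And>j. AE \<omega> in M.
      nn_cond_exp M (past_algebra M g j)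
        (\<lambda>\<omega>. ennreal \<bar>(gradient f (x j \<omega>) - g j \<omega>) \<bullet> s j \<omega>\<bar>) \<omega>
      \<le> ennreal (\<kappa>Gg\<^sup>2) *
        nn_cond_exp M (past_algebra M g j) (\<lambda>\<omega>. ennreal ((norm (s j \<omega>))\<^sup>2)) \<omega>"
  shows "integrable M (\<lambda>\<omega>. 1 / real (k + 1) * (\<Sum>j=0..k. norm (d j \<omega>))) \<and>
    integral\<^sup>L M (\<lambda>\<omega>. 1 / real (k + 1) * (\<Sum>j=0..k. norm (d j \<omega>)))
      \<le> kappa_conv CARD('n) varsigma \<tau> \<kappa>B (kappa_star \<kappa>s \<kappa>Gg \<kappa>B L)
           (f (closest_point (feasible_box l u) xini) - flow) / sqrt (real (k + 1))"
proof -
  interpret prob_space M by (rule prob)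
  define R where "R = \<kappa>Gg\<^sup>2 + (\<kappa>B + L) / 2"
  define \<Gamma>0 where "\<Gamma>0 = f (closest_point (feasible_box l u) xini) - flow"
  define c where "c = \<tau> * sqrt varsigma / (2 * \<kappa>B)"
  define e where "e j \<omega> = \<bar>(gradient f (x j \<omega>) - g j \<omega>) \<bullet> s j \<omega>\<bar>" for j \<omega>
  define q where "q j \<omega> = (norm (s j \<omega>))\<^sup>2" for j \<omega>
  define Z where "Z \<omega> = (\<Sum>i\<in>UNIV. w k \<omega> $ i)" for \<omega>
  define C where "C = real CARD('n)
    * (2 * (\<kappa>s\<^sup>2 * R) * (ln (4 * (\<kappa>s\<^sup>2 * R) / (c * sqrt varsigma)) - 1))"
  have R_pos: "0 < R"
    unfolding R_def using \<kappa>Gg_pos \<kappa>B_ge L_nonneg by (intro add_pos_pos) auto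
  have c_pos: "0 < c"
    unfolding c_def using params \<kappa>B_ge by simp
  have gradient: "GDERIV f y :> gradient f y" if "y \<in> feasible_box l u" for y
    using smooth domain(2) that unfolding twice_continuously_differentiable_on_def by blast

  have real: "AE \<omega> in M. adagb2_realization f l u xini varsigma \<tau> \<kappa>s L \<kappa>B flow
    (\<lambda>j. x j \<omega>) (\<lambda>j. g j \<omega>) (\<lambda>j. d j \<omega>) (\<lambda>j. w j \<omega>) (\<lambda>j. \<Delta> j \<omega>) (\<lambda>j. s j \<omega>) (\<lambda>j. B j \<omega>)"
    using algorithm B_bound
  proof eventually_elim
    case (elim \<omega>)
    then show ?case
      using params nonempty gradient lipschitz \<kappa>B_ge flow_bound
      by unfold_locales auto
  qed

  have "L-lipschitz_on UNIV (gradient f)"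
    using lipschitz L_nonneg by (intro lipschitz_onI) (auto simp: dist_norm)
  then have "continuous_on UNIV (gradient f)"
    by (rule lipschitz_on_continuous_on)
  then have [measurable]: "gradient f \<in> borel_measurable borel"
    by (rule borel_measurable_continuous_onI)
  have x_meas [measurable]: "x j \<in> borel_measurable M" for j
    using measurable_from_subalg[OF past_subalgebra adapted] meas(1) .
  note meas [measurable]
  have e_meas: "e j \<in> borel_measurable M" and q_meas [measurable]: "q j \<in> borel_measurable M" for j
    unfolding e_def q_def by measurable
  have Z_meas: "Z \<in> borel_measurable M"
    unfolding Z_def
    by (intro borel_measurable_sum measurable_compose[OF meas(3)]
        borel_measurable_continuous_onI continuous_intros)

  \<comment> \<open>The trust region bounds the steps uniformly, which starts the chain of integrability
    facts: from the steps to the gradient errors, to the weights, and to the claim.\<close>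
  have q_int: "integrable M (q j)" for j
  proof (rule integrable_const_bound[where B = "\<kappa>s\<^sup>2 * real CARD('n)"])
    show "AE \<omega> in M. norm (q j \<omega>) \<le> \<kappa>s\<^sup>2 * real CARD('n)"
      using real
    proof eventually_elim
      case (elim \<omega>)
      then show ?case
        using adagb2_realization.step_norm_sq_bounded[OF elim, of j] by (simp add: q_def)
    qed
  qed (rule q_meas)
  have e_int: "integrable M (e j)" and e_le: "expectation (e j) \<le> \<kappa>Gg\<^sup>2 * expectation (q j)" for j
    using expectation_le_if_cond_exp_le[OF prob past_subalgebra e_meas _ q_int, of g j j "\<kappa>Gg\<^sup>2" j]
      meas(1) error_bound[of j] by (simp_all add: e_def q_def)

  have Z_bounds: "AE \<omega> in M. 0 \<le> Z \<omega>
      \<and> (\<Sum>j\<le>k. norm (d j \<omega>)) \<le> sqrt (real (k + 1)) * Z \<omega>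
      \<and> c * Z \<omega> \<le> c * (real CARD('n) * sqrt varsigma) + \<Gamma>0
          + (\<Sum>j\<le>k. e j \<omega>) + (\<kappa>B + L) / 2 * (\<Sum>j\<le>k. q j \<omega>)
      \<and> R * (\<Sum>j\<le>k. q j \<omega>) \<le> c / 2 * Z \<omega> + C"
    using real
  proof eventually_elim
    case (elim \<omega>)
    interpret adagb2_realization f l u xini varsigma \<tau> \<kappa>s L \<kappa>B flow
      "\<lambda>j. x j \<omega>" "\<lambda>j. g j \<omega>" "\<lambda>j. d j \<omega>" "\<lambda>j. w j \<omega>" "\<lambda>j. \<Delta> j \<omega>" "\<lambda>j. s j \<omega>" "\<lambda>j. B j \<omega>"
      by (rule elim)
    show ?case
      using sum_norm_le_weights[of k] sum_weights_le[of k] sum_step_norm_sq_le_weights[OF R_pos, of k]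
      by (auto simp: Z_def e_def q_def \<Gamma>0_def C_def decrease_rate_def c_def[symmetric]
          intro!: sum_nonneg weight_nonneg)
  qed

  define Y where "Y \<omega> = c * (real CARD('n) * sqrt varsigma) + \<Gamma>0
    + (\<Sum>j\<le>k. e j \<omega>) + (\<kappa>B + L) / 2 * (\<Sum>j\<le>k. q j \<omega>)" for \<omega>
  have Y_int: "integrable M Y"
    unfolding Y_def using e_int q_int by auto
  have Z_int: "integrable M Z"
  proof (rule Bochner_Integration.integrable_bound)
    show "integrable M (\<lambda>\<omega>. 1 / c * Y \<omega>)"
      using Y_int by simp
    show "AE \<omega> in M. norm (Z \<omega>) \<le> norm (1 / c * Y \<omega>)"
      using Z_bounds
    proof eventually_elim
      case (elim \<omega>)
      then have "Z \<omega> \<le> 1 / c * Y \<omega>"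
        using c_pos by (simp add: Y_def field_simps)
      then show ?case
        using elim abs_ge_self[of "1 / c * Y \<omega>"] unfolding real_norm_def by linarith
    qed
  qed (rule Z_meas)
  have Rq: "expectation (\<lambda>\<omega>. R * (\<Sum>j\<le>k. q j \<omega>)) = R * (\<Sum>j\<le>k. expectation (q j))"
    using q_int by simp

  \<comment> \<open>The linear term in \<open>Z\<close> on the left is twice the one that the tangent
    line produces on the right.\<close>
  have "c * expectation Z = expectation (\<lambda>\<omega>. c * Z \<omega>)"
    by simp
  also have "\<dots> \<le> expectation Y"
    using Z_int Y_int Z_bounds unfolding Y_def by (intro integral_mono_AE) auto
  also have "\<dots> = c * (real CARD('n) * sqrt varsigma) + \<Gamma>0
      + (\<Sum>j\<le>k. expectation (e j)) + (\<kappa>B + L) / 2 * (\<Sum>j\<le>k. expectation (q j))"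
    unfolding Y_def using e_int q_int by (simp add: prob_space)
  also have "\<dots> \<le> c * (real CARD('n) * sqrt varsigma) + \<Gamma>0
      + (\<Sum>j\<le>k. \<kappa>Gg\<^sup>2 * expectation (q j)) + (\<kappa>B + L) / 2 * (\<Sum>j\<le>k. expectation (q j))"
    by (intro add_mono sum_mono e_le) auto
  also have "\<dots> = c * (real CARD('n) * sqrt varsigma) + \<Gamma>0
      + expectation (\<lambda>\<omega>. R * (\<Sum>j\<le>k. q j \<omega>))"
    unfolding Rq by (simp add: R_def sum_distrib_left[symmetric] distrib_right)
  also have "expectation (\<lambda>\<omega>. R * (\<Sum>j\<le>k. q j \<omega>)) \<le> expectation (\<lambda>\<omega>. c / 2 * Z \<omega> + C)"
    using Z_int q_int Z_bounds by (intro integral_mono_AE) auto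
  also have "\<dots> = c / 2 * expectation Z + C"
    using Z_int by (simp add: prob_space)
  finally have half: "c / 2 * expectation Z \<le> c * (real CARD('n) * sqrt varsigma) + \<Gamma>0 + C"
    by simp
  have K: "kappa_star \<kappa>s \<kappa>Gg \<kappa>B L = \<kappa>s\<^sup>2 * R"
    by (simp add: kappa_star_def R_def)
  \<comment> \<open>Here \<open>\<kappa>B \<ge> 1\<close> and \<open>\<kappa>s \<ge> 1\<close> keep the constant away from 0.\<close>
  have "1 * (1 / 2) \<le> \<kappa>s\<^sup>2 * R"
    using params \<kappa>B_ge L_nonneg \<kappa>Gg_pos R_pos unfolding R_def
    by (intro mult_mono) (auto intro: one_le_power add_increasing)
  then have Z_le: "expectation Z \<le> kappa_conv CARD('n) varsigma \<tau> \<kappa>B (kappa_star \<kappa>s \<kappa>Gg \<kappa>B L) \<Gamma>0"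
    unfolding K using half Z_bounds params \<kappa>B_ge
    by (intro le_kappa_conv[OF _ _ _ _ _ _ _ _ c_def])
      (auto simp: C_def Suc_le_eq intro!: integral_nonneg_AE)

  let ?S = "\<lambda>\<omega>. 1 / real (k + 1) * (\<Sum>j=0..k. norm (d j \<omega>))"
  have S_le: "AE \<omega> in M. ?S \<omega> \<le> Z \<omega> / sqrt (real (k + 1))"
    using Z_bounds
  proof eventually_elim
    case (elim \<omega>)
    then have "?S \<omega> \<le> 1 / real (k + 1) * (sqrt (real (k + 1)) * Z \<omega>)"
      unfolding atLeast0AtMost by (intro mult_left_mono) auto
    also have "\<dots> = Z \<omega> / sqrt (real (k + 1))"
      using real_div_sqrt[of "real (k + 1)"] by (simp add: field_simps)
    finally show ?case .
  qed
  have Z'_int: "integrable M (\<lambda>\<omega>. Z \<omega> / sqrt (real (k + 1)))"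
    using Z_int by simp
  have S_int: "integrable M ?S"
  proof (rule Bochner_Integration.integrable_bound[OF Z'_int])
    show "AE \<omega> in M. norm (?S \<omega>) \<le> norm (Z \<omega> / sqrt (real (k + 1)))"
      using S_le
    proof eventually_elim
      case (elim \<omega>)
      moreover have "0 \<le> ?S \<omega>"
        by (simp add: sum_nonneg)
      ultimately show ?case
        by (metis abs_of_nonneg order_trans real_norm_def)
    qed
  qed measurable
  have "integral\<^sup>L M ?S \<le> expectation (\<lambda>\<omega>. Z \<omega> / sqrt (real (k + 1)))"
    using S_int Z'_int S_le by (rule integral_mono_AE)
  also have "\<dots> = expectation Z / sqrt (real (k + 1))"
    by simp
  also have "\<dots> \<le> kappa_conv CARD('n) varsigma \<tau> \<kappa>B (kappa_star \<kappa>s \<kappa>Gg \<kappa>B L) \<Gamma>0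
      / sqrt (real (k + 1))"
    using Z_le by (intro divide_right_mono) auto
  finally show ?thesis
    using S_int unfolding \<Gamma>0_def by blast
qed

end
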